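(* Let $G$ be a probability distribution on $\mathbb R_+$ with $\mathbb E_{\theta\sim G}[\theta^4]\le M$ for some constant $M$. Then for any (deterministic) probability distribution $\hat G$ supported on $[0,\hat h]$, any $h>0$ with $G([0,h])>\frac12$, and any integer $K\ge1$, $$\mathsf{Regret}(\hat G;G)\le\left\{12(h^2+\hat h^2)+48(h+\hat h)K\right\}\left(H^2(f_G,f_{\hat G})+4G((h,\infty))\right)+2(h+\hat h)^2\epsilon_K(G)+2(1+2\sqrt2)\sqrt{(M+\hat h^4)\,G((h,\infty))}.$$
   Context: $\mathbb Z_+=\{0,1,2,\dots\}$, $\mathbb R_+=[0,\infty)$. For a probability distribution $G$ on $\mathbb R_+$ the Poisson mixture is $f_G(y)=\int e^{-\theta}\frac{\theta^y}{y!}\,G(d\theta)$, $y\in\mathbb Z_+$ (with $0^0=1$). $H^2(p,q)=\sum_{y\ge0}(\sqrt{p(y)}-\sqrt{q(y)})^2$. $\epsilon_K(G)=\sum_{y=K}^\infty f_G(y)=\mathbb P[Y\ge K]$ for $Y\sim f_G$. The Bayes estimator under prior $G$ is $\hat\theta_G(y)=(y+1)\frac{f_G(y+1)}{f_G(y)}$, with the convention $\hat\theta_G(y)=0$ if $f_G(y)=0$ (which happens only for $G=\delta_0$, $y>0$). For deterministic $\hat G$, $\mathsf{Regret}(\hat G;G)=\sum_{y\ge0}(\hat\theta_{\hat G}(y)-\hat\theta_G(y))^2f_G(y)$. *)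

theory Defs
  imports "HOL-Probability.Probability"
begin

text \<open>Distributions on the half-line or on \<open>[0, h]\<close> are Borel probability measures on the reals
  that are concentrated on the set in question.\<close>

definition distribution_on :: "real set \<Rightarrow> real measure \<Rightarrow> bool" where
  "distribution_on S G \<longleftrightarrow> real_distribution G \<and> (AE \<theta> in G. \<theta> \<in> S)"

definition poisson_mixture :: "real measure \<Rightarrow> nat \<Rightarrow> real" where
  "poisson_mixture G y = (\<integral>\<theta>. exp (-\<theta>) * \<theta> ^ y / fact y \<partial>G)"

definition sq_hellinger :: "(nat \<Rightarrow> real) \<Rightarrow> (nat \<Rightarrow> real) \<Rightarrow> real" where
  "sq_hellinger p q = (\<Sum>y. (sqrt (p y) - sqrt (q y))\<^sup>2)"

definition mixture_tail :: "nat \<Rightarrow> real measure \<Rightarrow> real" where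
  "mixture_tail K G = (\<Sum>y. poisson_mixture G (y + K))"

definition bayes_estimator :: "real measure \<Rightarrow> nat \<Rightarrow> real" where
  "bayes_estimator G y =
     (if poisson_mixture G y = 0 then 0
      else real (y + 1) * poisson_mixture G (y + 1) / poisson_mixture G y)"

text \<open>The regret takes values in \<open>[0, \<infinity>]\<close>, so that a real upper bound for it includes the
  convergence of the series.\<close>

definition regret :: "real measure \<Rightarrow> real measure \<Rightarrow> ennreal" where
  "regret G' G =
     (\<Sum>y. ennreal ((bayes_estimator G' y - bayes_estimator G y)\<^sup>2 * poisson_mixture G y))"

end

theory Submission
  imports Defs
begin

text \<open>Split the mixture \<open>F\<close> of \<open>G\<close> into the parts \<open>g\<close> and \<open>t\<close> that come from \<open>[0, h]\<close> and from
  \<open>(h, \<infinity>)\<close>, without normalising them. The Bayes rule minimises the posterior mean square error,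
  so for each \<open>y\<close> the regret is at most \<open>(a - b)\<^sup>2 g\<close>, where \<open>a\<close> and \<open>b\<close> are the Bayes rules
  belonging to \<open>G'\<close> and \<open>g\<close>, plus the square error of \<open>a\<close> over \<open>(h, \<infinity>)\<close>; by the fourth moment
  bound and the Cauchy-Schwarz inequality, the latter sums to the square root term.
  For \<open>y \<ge> K\<close> the bound \<open>\<bar>a - b\<bar> \<le> h + h'\<close> gives the tail term. For \<open>y < K\<close>, writing \<open>f\<close> for the
  mixture of \<open>G'\<close>, the identity
  \<open>(a - b) (f + g) = (a + b) (g - f) + 2 (a f - b g)\<close> together with
  \<open>a f(y) = (y + 1) f(y + 1)\<close> and \<open>b g(y) = (y + 1) g(y + 1)\<close> bounds \<open>(a - b)\<^sup>2 g\<close> by the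
  Hellinger terms at \<open>y\<close> and at \<open>y + 1\<close>.\<close>

section \<open>Poisson weights and the mixtures they generate\<close>

definition poisson_weight :: "nat \<Rightarrow> real \<Rightarrow> real" where
  "poisson_weight y \<theta> = exp (-\<theta>) * \<theta> ^ y / fact y"

lemma poisson_weight_measurable [measurable]: "poisson_weight y \<in> borel_measurable borel"
  unfolding poisson_weight_def by measurable

text \<open>Under the integral this trades a factor \<theta> for a shift of \<open>y\<close>, so
  that \<open>(y + 1) * f (y + 1)\<close> becomes an unnormalised posterior mean.\<close>

lemma poisson_weight_Suc: "\<theta> * poisson_weight y \<theta> = real (y + 1) * poisson_weight (y + 1) \<theta>"
  by (simp add: poisson_weight_def divide_simps)

lemma poisson_weight_nonneg: "\<theta> \<ge> 0 \<Longrightarrow> poisson_weight y \<theta> \<ge> 0"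
  by (simp add: poisson_weight_def)

lemma poisson_weight_sums: "(\<lambda>y. poisson_weight y \<theta>) sums 1"
proof -
  have "(\<lambda>y. exp (-\<theta>) * (\<theta> ^ y /\<^sub>R fact y)) sums (exp (-\<theta>) * exp \<theta>)"
    by (intro sums_mult exp_converges)
  then show ?thesis
    by (simp add: poisson_weight_def field_simps flip: exp_add)
qed

lemma poisson_weight_le_1:
  assumes "\<theta> \<ge> 0" shows "poisson_weight y \<theta> \<le> 1"
proof -
  have "(\<Sum>i\<in>{y}. poisson_weight i \<theta>) \<le> (\<Sum>i. poisson_weight i \<theta>)"
    using poisson_weight_sums[of \<theta>] assms
    by (intro sum_le_suminf) (auto simp: sums_iff poisson_weight_nonneg)
  then show ?thesis using poisson_weight_sums[of \<theta>] by (simp add: sums_iff)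
qed

lemma integrable_mult_poisson_weight:
  fixes \<phi> :: "real \<Rightarrow> real"
  assumes "distribution_on {0..} G" and int: "integrable G \<phi>"
  shows "integrable G (\<lambda>\<theta>. \<phi> \<theta> * poisson_weight y \<theta>)"
proof (rule Bochner_Integration.integrable_bound[OF int])
  interpret real_distribution G using assms by (simp add: distribution_on_def)
  show "(\<lambda>\<theta>. \<phi> \<theta> * poisson_weight y \<theta>) \<in> borel_measurable G"
    using int by measurable
  have "AE \<theta> in G. \<theta> \<in> {0..}" using assms by (simp add: distribution_on_def)
  then show "AE \<theta> in G. norm (\<phi> \<theta> * poisson_weight y \<theta>) \<le> norm (\<phi> \<theta>)"
    by eventually_elim
      (auto simp: abs_mult poisson_weight_nonneg intro!: mult_left_le poisson_weight_le_1)
qed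

text \<open>For each \<theta> the weights sum to 1, and nonnegativity lets sum and integral be
  exchanged. The exchange is made in \<open>ennreal\<close> and then carried back to the reals. With
  \<phi> an indicator times a power, it later sums the pieces of the split mixture.\<close>

lemma mult_poisson_weight_sums:
  fixes \<phi> :: "real \<Rightarrow> real"
  assumes G: "distribution_on {0..} G" and int: "integrable G \<phi>" and nn: "\<And>\<theta>. \<theta> \<ge> 0 \<Longrightarrow> \<phi> \<theta> \<ge> 0"
  shows "(\<lambda>y. \<integral>\<theta>. \<phi> \<theta> * poisson_weight y \<theta> \<partial>G) sums (\<integral>\<theta>. \<phi> \<theta> \<partial>G)"
proof -
  interpret real_distribution G using G by (simp add: distribution_on_def)
  have ae: "AE \<theta> in G. \<theta> \<in> {0..}" using G by (simp add: distribution_on_def)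
  have aenn: "AE \<theta> in G. 0 \<le> \<phi> \<theta> * poisson_weight y \<theta>" for y
    using ae by eventually_elim (auto simp: nn poisson_weight_nonneg)
  have aenn': "AE \<theta> in G. 0 \<le> \<phi> \<theta>"
    using ae by eventually_elim (auto simp: nn)
  have [measurable]: "\<phi> \<in> borel_measurable G" using int by simp
  have "(\<Sum>y. ennreal (\<integral>\<theta>. \<phi> \<theta> * poisson_weight y \<theta> \<partial>G))
      = (\<Sum>y. \<integral>\<^sup>+\<theta>. ennreal (\<phi> \<theta> * poisson_weight y \<theta>) \<partial>G)"
    by (intro suminf_cong nn_integral_eq_integral[symmetric]
        integrable_mult_poisson_weight[OF G int] aenn)
  also have "\<dots> = (\<integral>\<^sup>+\<theta>. (\<Sum>y. ennreal (\<phi> \<theta> * poisson_weight y \<theta>)) \<partial>G)"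
    by (rule nn_integral_suminf[symmetric]) measurable
  also have "\<dots> = (\<integral>\<^sup>+\<theta>. ennreal (\<phi> \<theta>) \<partial>G)"
  proof (rule nn_integral_cong_AE)
    show "AE \<theta> in G. (\<Sum>y. ennreal (\<phi> \<theta> * poisson_weight y \<theta>)) = ennreal (\<phi> \<theta>)"
      using ae
    proof eventually_elim
      case (elim \<theta>)
      then have "(\<lambda>y. \<phi> \<theta> * poisson_weight y \<theta>) sums (\<phi> \<theta> * 1)"
        by (intro sums_mult poisson_weight_sums)
      with elim show ?case
        by (subst suminf_ennreal2) (auto simp: nn poisson_weight_nonneg sums_iff)
    qed
  qed
  also have "\<dots> = ennreal (\<integral>\<theta>. \<phi> \<theta> \<partial>G)"
    by (rule nn_integral_eq_integral[OF int aenn'])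
  finally have "(\<lambda>y. ennreal (\<integral>\<theta>. \<phi> \<theta> * poisson_weight y \<theta> \<partial>G)) sums ennreal (\<integral>\<theta>. \<phi> \<theta> \<partial>G)"
    by (simp add: sums_iff)
  then show ?thesis
    by (subst (asm) sums_ennreal) (auto intro: integral_nonneg_AE aenn aenn')
qed

lemma poisson_mixture_eq: "poisson_mixture G y = (\<integral>\<theta>. poisson_weight y \<theta> \<partial>G)"
  by (simp add: poisson_mixture_def poisson_weight_def)

lemma poisson_mixture_nonneg:
  assumes "distribution_on {0..} G" shows "poisson_mixture G y \<ge> 0"
  unfolding poisson_mixture_eq
  using assms by (intro integral_nonneg_AE)
    (auto simp: distribution_on_def poisson_weight_nonneg elim!: eventually_mono)

lemma poisson_mixture_sums:
  assumes "distribution_on {0..} G" shows "poisson_mixture G sums 1"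
proof -
  interpret real_distribution G using assms by (simp add: distribution_on_def)
  show ?thesis
    using mult_poisson_weight_sums[OF assms, of "\<lambda>_. 1"]
    using prob_space by (simp add: poisson_mixture_eq[abs_def])
qed

section \<open>Bayes rules of bounded priors\<close>

lemma distribution_on_mono: "distribution_on S G \<Longrightarrow> S \<subseteq> T \<Longrightarrow> distribution_on T G"
  by (auto simp: distribution_on_def elim!: eventually_mono)

text \<open>The Bayes rule is a posterior mean and so stays in the range of the prior. The product
  formula survives the default value 0: if the mixture vanishes at \<open>y\<close>, the bound by
  \<open>h\<close> makes it vanish at \<open>y + 1\<close> too.\<close>

lemma bayes_estimator_bounds:
  assumes G: "distribution_on {0..h} G"
  shows "bayes_estimator G y \<ge> 0" "bayes_estimator G y \<le> h"
    and "bayes_estimator G y * poisson_mixture G y = real (y + 1) * poisson_mixture G (y + 1)"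
proof -
  have G0: "distribution_on {0..} G" by (rule distribution_on_mono[OF G]) auto
  interpret real_distribution G using G by (simp add: distribution_on_def)
  have ae: "AE \<theta> in G. \<theta> \<in> {0..h}" using G by (simp add: distribution_on_def)
  have "h \<ge> 0"
  proof (rule ccontr)
    assume "\<not> h \<ge> 0"
    then have "{0..h} = {}" by simp
    with ae show False by simp
  qed
  have int: "integrable G (poisson_weight y)" for y
    using integrable_mult_poisson_weight[OF G0, of "\<lambda>_. 1"] by simp
  have "real (y + 1) * poisson_mixture G (y + 1) = (\<integral>\<theta>. \<theta> * poisson_weight y \<theta> \<partial>G)"
    unfolding poisson_mixture_eq poisson_weight_Suc by simp
  also have "\<dots> \<le> (\<integral>\<theta>. h * poisson_weight y \<theta> \<partial>G)"
  proof (rule integral_mono_AE)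
    show "integrable G (\<lambda>\<theta>. \<theta> * poisson_weight y \<theta>)"
      unfolding poisson_weight_Suc using int by simp
    show "integrable G (\<lambda>\<theta>. h * poisson_weight y \<theta>)" using int by simp
    show "AE \<theta> in G. \<theta> * poisson_weight y \<theta> \<le> h * poisson_weight y \<theta>"
      using ae by eventually_elim (auto intro!: mult_right_mono poisson_weight_nonneg)
  qed
  also have "\<dots> = h * poisson_mixture G y" by (simp add: poisson_mixture_eq)
  finally have le: "real (y + 1) * poisson_mixture G (y + 1) \<le> h * poisson_mixture G y" .
  have nn: "poisson_mixture G y \<ge> 0" "poisson_mixture G (y + 1) \<ge> 0"
    by (auto intro: poisson_mixture_nonneg G0)
  show "bayes_estimator G y \<ge> 0" using nn by (simp add: bayes_estimator_def)
  show "bayes_estimator G y \<le> h"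
    using nn le \<open>h \<ge> 0\<close> by (auto simp: bayes_estimator_def divide_simps)
  show "bayes_estimator G y * poisson_mixture G y = real (y + 1) * poisson_mixture G (y + 1)"
    using nn le by (auto simp: bayes_estimator_def mult_le_0_iff)
qed

section \<open>Real inequalities behind the pointwise bounds\<close>

lemma sqrt_diff_square_le_add:
  fixes x y :: real assumes "x \<ge> 0" "y \<ge> 0"
  shows "(sqrt x - sqrt y)\<^sup>2 \<le> x + y"
  using assms by (simp add: power2_diff)

lemma sqrt_diff_square_le_diff:
  fixes x y :: real assumes "0 \<le> y" "y \<le> x"
  shows "(sqrt x - sqrt y)\<^sup>2 \<le> x - y"
proof -
  have "sqrt y * sqrt y \<le> sqrt x * sqrt y" using assms by (intro mult_right_mono) auto
  then show ?thesis using assms by (simp add: power2_diff)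
qed

text \<open>Turns differences of mixture values into Hellinger terms; the price is the factor
  \<open>x + y\<close>, which is cancelled later.\<close>

lemma diff_square_le_sqrt_diff_square:
  fixes x y :: real assumes "x \<ge> 0" "y \<ge> 0"
  shows "(x - y)\<^sup>2 \<le> 2 * (x + y) * (sqrt x - sqrt y)\<^sup>2"
proof -
  have "x - y = (sqrt x + sqrt y) * (sqrt x - sqrt y)"
    using assms by (simp add: algebra_simps)
  then have "(x - y)\<^sup>2 = (sqrt x + sqrt y)\<^sup>2 * (sqrt x - sqrt y)\<^sup>2"
    by (metis power_mult_distrib)
  also have "(sqrt x + sqrt y)\<^sup>2 \<le> 2 * (x + y)"
    using assms sum_squares_ge_zero zero_le_power2[of "sqrt x - sqrt y"]
    by (simp add: power2_sum power2_diff)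
  finally show ?thesis by (simp add: mult_right_mono)
qed

lemma square_add3_le: "(x + y + z)\<^sup>2 \<le> 3 * (x\<^sup>2 + y\<^sup>2 + z\<^sup>2)" for x y z :: real
proof -
  have "0 \<le> (x - y)\<^sup>2 + (y - z)\<^sup>2 + (x - z)\<^sup>2" by simp
  then show ?thesis by (simp add: power2_eq_square algebra_simps)
qed

lemma square_diff_le: "(u - v)\<^sup>2 \<le> 2 * (x - u)\<^sup>2 + 2 * (x - v)\<^sup>2" for x u v :: real
proof -
  have "0 \<le> ((x - u) + (x - v))\<^sup>2" by simp
  then show ?thesis by (simp add: power2_eq_square algebra_simps)
qed

text \<open>Here \<open>f1\<close> and \<open>g1\<close> stand for the values at
  \<open>y + 1\<close>, \<open>k\<close> for \<open>y + 1\<close> and \<open>N\<close> for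
  \<open>K\<close>. After multiplication by \<open>s = f + g\<close>, both terms on the right
  acquire a factor \<open>s\<close>, so one power of \<open>s\<close> cancels.\<close>

lemma bayes_diff_square_le:
  fixes a b f g f1 g1 h h' k N :: real
  assumes f: "f \<ge> 0" and g: "g \<ge> 0" and f1: "f1 \<ge> 0" and g1: "g1 \<ge> 0"
    and a: "0 \<le> a" "a \<le> h'" and b: "0 \<le> b" "b \<le> h"
    and af: "a * f = k * f1" and bg: "b * g = k * g1" and k: "0 \<le> k" "k \<le> N"
  shows "(a - b)\<^sup>2 * g \<le> 6 * (h\<^sup>2 + h'\<^sup>2) * (sqrt f - sqrt g)\<^sup>2
           + 24 * (h + h') * N * (sqrt f1 - sqrt g1)\<^sup>2"
proof (cases "g = 0")
  case True
  then show ?thesis using assms by simp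
next
  case False
  define s where "s = f + g"
  have s: "s > 0" "g \<le> s" using False f g by (auto simp: s_def)
  define D D1 where "D = (sqrt f - sqrt g)\<^sup>2" and "D1 = (sqrt f1 - sqrt g1)\<^sup>2"
  have D: "D \<ge> 0" "D1 \<ge> 0" by (auto simp: D_def D1_def)
  have gs: "g * X \<le> s * X" if "X \<ge> 0" for X using s that by (intro mult_right_mono) auto
  have fg: "(g - f)\<^sup>2 \<le> 2 * s * D"
    using diff_square_le_sqrt_diff_square[OF f g]
    by (simp add: s_def D_def power2_commute)
  have "(a - b) * s = a * (g - f) + 2 * k * (f1 - g1) + b * (g - f)"
    using af bg by (simp add: s_def algebra_simps)
  then have "((a - b) * s)\<^sup>2 \<le> 3 * ((a * (g - f))\<^sup>2 + (2 * k * (f1 - g1))\<^sup>2 + (b * (g - f))\<^sup>2)"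
    using square_add3_le by simp
  also have "\<dots> = 3 * (a\<^sup>2 + b\<^sup>2) * (g - f)\<^sup>2 + 12 * k\<^sup>2 * (f1 - g1)\<^sup>2"
    by (simp only: power_mult_distrib) (simp add: distrib_left distrib_right)
  also have "3 * (a\<^sup>2 + b\<^sup>2) * (g - f)\<^sup>2 \<le> 3 * (h'\<^sup>2 + h\<^sup>2) * (2 * s * D)"
    using fg a b s D by (intro mult_mono add_mono power_mono) auto
  also have "12 * k\<^sup>2 * (f1 - g1)\<^sup>2 \<le> 12 * k\<^sup>2 * (2 * (f1 + g1) * D1)"
    unfolding D1_def by (intro mult_left_mono diff_square_le_sqrt_diff_square f1 g1) auto
  \<comment> \<open>One of the two factors \<open>k\<close> is absorbed by
    \<open>k * f1 = a * f\<close> and \<open>k * g1 = b * g\<close>. This keeps the bound linear in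
    \<open>N\<close> and yields the factor \<open>s\<close>.\<close>
  also have "\<dots> = 24 * k * (a * f + b * g) * D1"
    unfolding af bg by (simp add: power2_eq_square algebra_simps)
  also have "\<dots> \<le> 24 * N * ((h + h') * s) * D1"
  proof -
    have "a * f + b * g \<le> (h + h') * f + (h + h') * g"
      using a b f g by (intro add_mono mult_right_mono) auto
    then have "a * f + b * g \<le> (h + h') * s" by (simp add: s_def algebra_simps)
    then show ?thesis using k a b f g D
      by (intro mult_right_mono mult_mono mult_left_mono) auto
  qed
  finally have "(a - b)\<^sup>2 * s * s \<le> (6 * (h\<^sup>2 + h'\<^sup>2) * D + 24 * (h + h') * N * D1) * s"
    by (simp add: power2_eq_square algebra_simps)
  then have "(a - b)\<^sup>2 * s \<le> 6 * (h\<^sup>2 + h'\<^sup>2) * D + 24 * (h + h') * N * D1"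
    using s by (simp only: mult_le_cancel_right_pos)
  moreover have "(a - b)\<^sup>2 * g \<le> (a - b)\<^sup>2 * s" using s by (intro mult_left_mono) auto
  ultimately show ?thesis by (simp add: D_def D1_def)
qed

text \<open>The variables \<open>t\<close>, \<open>t1\<close>, \<open>t2\<close> stand for the
  moments of order 0, 1, 2 over \<open>(h, \<infinity>)\<close>, and \<open>tc\<close> says that the
  square error of \<open>c\<close> there is nonnegative. The left-hand side is the excess of the
  risk of \<open>a\<close> over that of \<open>c\<close>. The risk of \<open>c\<close> is bounded
  below by the minimum at \<open>b\<close> on the part \<open>g\<close> and by 0 on the tail; in the
  tail risk of \<open>a\<close> the cross term \<open>-2 * a * t1\<close> is dropped.\<close>

lemma bayes_regret_split:
  fixes a b c F g t t1 t2 h' :: real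
  assumes F: "F = g + t" and c: "c * F = b * g + t1" and g: "g \<ge> 0"
    and t1: "t1 \<ge> 0" and t: "t \<ge> 0" and a: "0 \<le> a" "a \<le> h'"
    and tc: "t2 - 2 * c * t1 + c\<^sup>2 * t \<ge> 0"
  shows "(a - c)\<^sup>2 * F \<le> (a - b)\<^sup>2 * g + h'\<^sup>2 * t + t2"
proof -
  have "(b - c)\<^sup>2 * g \<ge> 0" using g by simp
  with tc have "2 * c * (b * g + t1) - c\<^sup>2 * (g + t) \<le> b\<^sup>2 * g + t2"
    by (simp add: power2_eq_square algebra_simps)
  \<comment> \<open>Since \<open>b * g + t1 = c * F\<close>, the left-hand side above is
    \<open>2 * c\<^sup>2 * F - c\<^sup>2 * F\<close>.\<close>
  then have "c\<^sup>2 * F \<le> b\<^sup>2 * g + t2"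
    unfolding F[symmetric] c[symmetric] by (simp add: power2_eq_square mult_ac)
  moreover have "(a - c)\<^sup>2 * F = a\<^sup>2 * F - 2 * a * (b * g + t1) + c\<^sup>2 * F"
    unfolding c[symmetric] by (simp add: power2_eq_square algebra_simps)
  moreover have "a\<^sup>2 * F - 2 * a * (b * g + t1) + (b\<^sup>2 * g + t2)
      = (a - b)\<^sup>2 * g + a\<^sup>2 * t - 2 * (a * t1) + t2"
    by (simp add: F power2_eq_square algebra_simps)
  moreover have "a\<^sup>2 * t \<le> h'\<^sup>2 * t" using a t by (intro mult_right_mono power_mono) auto
  moreover have "a * t1 \<ge> 0" using a t1 by simp
  ultimately show ?thesis by linarith
qed

text \<open>Cauchy-Schwarz for the indicator of \<open>A\<close> and \<open>u\<^sup>2\<close>, the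
  indicator being its own square. It controls the second moment over
  \<open>(h, \<infinity>)\<close>.\<close>

lemma (in finite_measure) integral_square_on_le_sqrt:
  fixes u :: "'a \<Rightarrow> real"
  assumes A [measurable]: "A \<in> sets M" and u [measurable]: "u \<in> borel_measurable M"
    and int: "integrable M (\<lambda>x. u x ^ 4)" and int2: "integrable M (\<lambda>x. indicator A x * (u x)\<^sup>2)"
  shows "(\<integral>x. indicator A x * (u x)\<^sup>2 \<partial>M) \<le> sqrt ((\<integral>x. u x ^ 4 \<partial>M) * measure M A)"
proof -
  have "(\<integral>\<^sup>+x. ennreal (indicator A x) * ennreal ((u x)\<^sup>2) \<partial>M)\<^sup>2
      \<le> (\<integral>\<^sup>+x. (ennreal (indicator A x))\<^sup>2 \<partial>M) * (\<integral>\<^sup>+x. (ennreal ((u x)\<^sup>2))\<^sup>2 \<partial>M)"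
    by (rule Cauchy_Schwarz_nn_integral) measurable
  also have "(\<integral>\<^sup>+x. ennreal (indicator A x) * ennreal ((u x)\<^sup>2) \<partial>M)
      = ennreal (\<integral>x. indicator A x * (u x)\<^sup>2 \<partial>M)"
    by (subst nn_integral_eq_integral[OF int2, symmetric]) (auto simp: ennreal_mult)
  also have "(\<integral>\<^sup>+x. (ennreal ((u x)\<^sup>2))\<^sup>2 \<partial>M) = ennreal (\<integral>x. u x ^ 4 \<partial>M)"
    by (subst nn_integral_eq_integral[OF int, symmetric]) (auto simp: ennreal_power)
  also have "(\<integral>\<^sup>+x. (ennreal (indicator A x))\<^sup>2 \<partial>M) = (\<integral>\<^sup>+x. indicator A x \<partial>M)"
    by (intro nn_integral_cong) (auto simp: indicator_def)
  also have "\<dots> = ennreal (measure M A)" by (simp add: emeasure_eq_measure)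
  finally have "ennreal ((\<integral>x. indicator A x * (u x)\<^sup>2 \<partial>M)\<^sup>2)
      \<le> ennreal ((\<integral>x. u x ^ 4 \<partial>M) * measure M A)"
    by (simp add: ennreal_power ennreal_mult mult.commute)
  then have "(\<integral>x. indicator A x * (u x)\<^sup>2 \<partial>M)\<^sup>2 \<le> (\<integral>x. u x ^ 4 \<partial>M) * measure M A"
    by (subst (asm) ennreal_le_iff) auto
  then show ?thesis by (rule real_le_rsqrt)
qed

theorem lemma4:
  fixes G G' :: "real measure" and M h h' :: real and K :: nat
  assumes "distribution_on {0..} G"
    and "integrable G (\<lambda>\<theta>. \<theta> ^ 4)" and "(\<integral>\<theta>. \<theta> ^ 4 \<partial>G) \<le> M"
    and "distribution_on {0..h'} G'"
    and "h > 0" and "measure G {0..h} > 1 / 2"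
    and "K \<ge> 1"
  shows "regret G' G \<le> ennreal (
      (12 * (h\<^sup>2 + h'\<^sup>2) + 48 * (h + h') * real K)
        * (sq_hellinger (poisson_mixture G) (poisson_mixture G') + 4 * measure G {h<..})
      + 2 * (h + h')\<^sup>2 * mixture_tail K G
      + 2 * (1 + 2 * sqrt 2) * sqrt ((M + h' ^ 4) * measure G {h<..}))"
proof -
  note G = assms(1) and M4 = assms(2,3) and G'h = assms(4) and h = assms(5)
  interpret real_distribution G using G by (simp add: distribution_on_def)
  have ae: "AE \<theta> in G. \<theta> \<in> {0..}" using G by (simp add: distribution_on_def)
  have G': "distribution_on {0..} G'" by (rule distribution_on_mono[OF G'h]) auto
  define p where "p = measure G {h<..}"
  have p: "0 \<le> p" "p \<le> 1" by (auto simp: p_def)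
  define F f where "F = poisson_mixture G" and "f = poisson_mixture G'"
  define a c where "a = bayes_estimator G'" and "c = bayes_estimator G"
  \<comment> \<open>The unnormalised posterior moment of order \<open>k\<close> restricted to
    \<open>A\<close>, bracketed to match the form \<phi> times weight.\<close>
  define part where "part A k y = (\<integral>\<theta>. (indicator A \<theta> * \<theta> ^ k) * poisson_weight y \<theta> \<partial>G)"
    for A and k y :: nat
  define g t where "g = part {0..h} 0" and "t = part {h<..} 0"
  define t1 t2 where "t1 = part {h<..} 1" and "t2 = part {h<..} 2"
  \<comment> \<open>A Bayes rule is a ratio of mixture values, so the unnormalised \<open>g\<close>
    gives the rule of the normalised restriction of \<open>G\<close>.\<close>
  define b where "b y = (if g y = 0 then 0 else real (y + 1) * g (y + 1) / g y)" for y

  \<comment> \<open>Restricted moments: integrability, sums and shift\<close>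
  have int_pow: "integrable G (\<lambda>\<theta>. \<theta> ^ k)" if "k \<le> 4" for k
  proof (rule Bochner_Integration.integrable_bound)
    show "integrable G (\<lambda>\<theta>. 1 + \<theta> ^ 4)" using M4 by simp
    show "AE \<theta> in G. norm (\<theta> ^ k) \<le> norm (1 + \<theta> ^ 4)"
      using ae
    proof eventually_elim
      case (elim \<theta>)
      have "\<theta> ^ k \<le> 1 + \<theta> ^ 4"
      proof (cases "\<theta> \<le> 1")
        case True
        then have "\<theta> ^ k \<le> 1" using elim by (simp add: power_le_one)
        moreover have "0 \<le> \<theta> ^ 4" by simp
        ultimately show ?thesis by linarith
      next
        case False
        then have "\<theta> ^ k \<le> \<theta> ^ 4" using that by (intro power_increasing) auto
        then show ?thesis by simp
      qed
      with elim show ?case by simp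
    qed
  qed simp
  have int_ind: "integrable G (\<lambda>\<theta>. indicator A \<theta> * \<theta> ^ k)"
    if "k \<le> 4" "A \<in> sets borel" for A :: "real set" and k
    using integrable_mult_indicator[OF _ int_pow[OF that(1)], of A] that by simp
  have int_part: "integrable G (\<lambda>\<theta>. (indicator A \<theta> * \<theta> ^ k) * poisson_weight y \<theta>)"
    if "k \<le> 4" "A \<in> sets borel" for A :: "real set" and k y
    by (rule integrable_mult_poisson_weight[OF G int_ind[OF that]])
  have part_sums: "part A k sums (\<integral>\<theta>. indicator A \<theta> * \<theta> ^ k \<partial>G)"
    if "k \<le> 4" "A \<in> sets borel" for A k
    unfolding part_def[abs_def] using that
    by (intro mult_poisson_weight_sums[OF G] int_ind) auto
  have part_nonneg: "part A k y \<ge> 0" for A k y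
    unfolding part_def using ae
    by (intro integral_nonneg_AE) (auto simp: poisson_weight_nonneg elim!: eventually_mono)
  have part_Suc: "part A (Suc k) y = real (y + 1) * part A k (y + 1)" for A k y
  proof -
    have "(indicator A \<theta> * \<theta> ^ Suc k) * poisson_weight y \<theta>
        = real (y + 1) * ((indicator A \<theta> * \<theta> ^ k) * poisson_weight (y + 1) \<theta>)" for \<theta>
      using arg_cong[OF poisson_weight_Suc[of \<theta> y], of "\<lambda>x. (indicator A \<theta> * \<theta> ^ k) * x"]
      by (simp add: mult_ac)
    then show ?thesis unfolding part_def by (simp only: integral_mult_right_zero)
  qed

  \<comment> \<open>Splitting the mixture and the Bayes rule at \<open>h\<close>\<close>
  have F_split: "F y = g y + t y" for y
  proof -
    have "F y = (\<integral>\<theta>. (indicator {0..h} \<theta> * \<theta> ^ 0) * poisson_weight y \<theta>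
        + (indicator {h<..} \<theta> * \<theta> ^ 0) * poisson_weight y \<theta> \<partial>G)"
      unfolding F_def poisson_mixture_eq using ae
      by (intro integral_cong_AE) (auto simp: indicator_def elim!: eventually_mono)
    also have "\<dots> = g y + t y"
      unfolding g_def t_def part_def by (intro Bochner_Integration.integral_add int_part) auto
    finally show ?thesis .
  qed
  have t_sums: "t sums p"
    using part_sums[of 0 "{h<..}"] by (simp add: t_def p_def)
  have nn: "F y \<ge> 0" "f y \<ge> 0" "g y \<ge> 0" "t y \<ge> 0" "t1 y \<ge> 0" for y
    by (auto simp: F_def f_def g_def t_def t1_def part_nonneg
        intro: poisson_mixture_nonneg G G')
  have F_sums: "F sums 1" and f_sums: "f sums 1"
    unfolding F_def f_def by (intro poisson_mixture_sums G G')+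

  have a: "0 \<le> a y" "a y \<le> h'" "a y * f y = real (y + 1) * f (y + 1)" for y
    unfolding a_def f_def by (rule bayes_estimator_bounds[OF G'h])+
  have h': "h' \<ge> 0" using a(1,2)[of 0] by linarith
  have gle: "real (y + 1) * g (y + 1) \<le> h * g y" for y
  proof -
    have "real (y + 1) * g (y + 1) = part {0..h} 1 y" using part_Suc[of _ 0] by (simp add: g_def)
    also have "\<dots> \<le> (\<integral>\<theta>. h * ((indicator {0..h} \<theta> * \<theta> ^ 0) * poisson_weight y \<theta>) \<partial>G)"
      unfolding part_def
      by (intro integral_mono int_part integrable_mult_right)
        (auto simp: indicator_def intro!: mult_right_mono poisson_weight_nonneg)
    also have "\<dots> = h * g y" unfolding g_def part_def by simp
    finally show ?thesis .
  qed
  have b: "0 \<le> b y" "b y \<le> h" "b y * g y = real (y + 1) * g (y + 1)" for y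
  proof -
    show "0 \<le> b y" using nn by (simp add: b_def)
    show "b y \<le> h" using nn(3)[of y] gle[of y] h by (auto simp: b_def divide_simps)
    show "b y * g y = real (y + 1) * g (y + 1)"
      using nn(3)[of "y + 1"] gle[of y] by (auto simp: b_def mult_le_0_iff)
  qed
  have cF: "c y * F y = b y * g y + t1 y" for y
  proof -
    have "b y * g y + t1 y = real (y + 1) * F (y + 1)"
      unfolding b using part_Suc[of _ 0] by (simp add: t1_def t_def F_split algebra_simps)
    \<comment> \<open>Where \<open>F y = 0\<close>, the default makes \<open>c y * F y\<close> zero,
      so the right-hand side has to vanish as well. A zero integral of the nonnegative tail
      integrand makes it zero almost everywhere, also after multiplication by \<theta>.\<close>
    moreover have "t1 y = 0" if "F y = 0"
    proof -
      have "t y = 0" using that F_split[of y] nn(3,4)[of y] by linarith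
      then have "(\<integral>\<theta>. (indicator {h<..} \<theta> * \<theta> ^ 0) * poisson_weight y \<theta> \<partial>G) = 0"
        by (simp add: t_def part_def)
      then have "AE \<theta> in G. (indicator {h<..} \<theta> * \<theta> ^ 0) * poisson_weight y \<theta> = 0"
        by (subst (asm) integral_nonneg_eq_0_iff_AE)
          (use ae int_part[of 0 "{h<..}" y] in
            \<open>auto simp: poisson_weight_nonneg elim!: eventually_mono\<close>)
      then have "AE \<theta> in G. (indicator {h<..} \<theta> * \<theta> ^ 1) * poisson_weight y \<theta> = 0"
        by eventually_elim auto
      then show ?thesis unfolding t1_def part_def by (rule integral_eq_zero_AE)
    qed
    moreover have "g y = 0" if "F y = 0" using that F_split[of y] nn(3,4)[of y] by linarith
    ultimately show ?thesis by (auto simp: c_def bayes_estimator_def F_def[symmetric])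
  qed
  \<comment> \<open>This is the expanded square error of the constant estimate \<open>c y\<close>
    over \<open>(h, \<infinity>)\<close>.\<close>
  have tc: "t2 y - 2 * c y * t1 y + (c y)\<^sup>2 * t y \<ge> 0" for y
  proof -
    let ?p = "\<lambda>k \<theta>. (indicator {h<..} \<theta> * \<theta> ^ k) * poisson_weight y \<theta>"
    have "t2 y - 2 * c y * t1 y + (c y)\<^sup>2 * t y
        = (\<integral>\<theta>. ?p 2 \<theta> - 2 * c y * ?p 1 \<theta> + (c y)\<^sup>2 * ?p 0 \<theta> \<partial>G)"
      unfolding t_def t1_def t2_def part_def
      using int_part[of 0 "{h<..}" y] int_part[of 1 "{h<..}" y] int_part[of 2 "{h<..}" y] by simp
    also have "\<dots> = (\<integral>\<theta>. indicator {h<..} \<theta> * (\<theta> - c y)\<^sup>2 * poisson_weight y \<theta> \<partial>G)"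
      by (intro Bochner_Integration.integral_cong) (auto simp: power2_eq_square algebra_simps)
    also have "\<dots> \<ge> 0"
      using ae by (intro integral_nonneg_AE)
        (auto simp: poisson_weight_nonneg elim!: eventually_mono)
    finally show ?thesis .
  qed

  \<comment> \<open>Hellinger sums against the truncated mixture\<close>
  define D where "D y = (sqrt (f y) - sqrt (g y))\<^sup>2" for y
  define H where "H y = (sqrt (F y) - sqrt (f y))\<^sup>2" for y
  have D_nonneg: "D y \<ge> 0" for y by (simp add: D_def)
  have H_summable: "summable H"
  proof (rule summable_comparison_test')
    show "summable (\<lambda>y. F y + f y)" using F_sums f_sums by (auto intro: summable_add sums_summable)
    show "norm (H y) \<le> F y + f y" for y
      using sqrt_diff_square_le_add[OF nn(1,2)] by (simp add: H_def)
  qed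
  \<comment> \<open>The passage from \<open>f\<close> to \<open>g\<close> goes through
    \<open>F\<close>: since \<open>F - g = t\<close>, the second leg costs at most
    \<open>t y\<close>, which sums to \<open>p\<close>.\<close>
  have D_le: "D y \<le> 2 * H y + 2 * t y" for y
  proof -
    have "D y \<le> 2 * (sqrt (F y) - sqrt (f y))\<^sup>2 + 2 * (sqrt (F y) - sqrt (g y))\<^sup>2"
      unfolding D_def by (rule square_diff_le)
    also have "(sqrt (F y) - sqrt (g y))\<^sup>2 \<le> t y"
      using sqrt_diff_square_le_diff[of "g y" "F y"] nn F_split[of y] by simp
    finally show ?thesis by (simp add: H_def)
  qed
  have Ht_summable: "summable (\<lambda>y. 2 * H y + 2 * t y)"
    using H_summable t_sums by (intro summable_add summable_mult) (auto intro: sums_summable)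
  have D_summable: "summable D"
    by (rule summable_comparison_test'[OF Ht_summable]) (use D_le D_nonneg in auto)
  have "suminf D \<le> (\<Sum>y. 2 * H y + 2 * t y)"
    by (intro suminf_le D_le D_summable Ht_summable)
  also have "\<dots> = 2 * suminf H + 2 * p"
    using sums_add[OF sums_mult[OF summable_sums[OF H_summable]] sums_mult[OF t_sums]]
    by (simp add: sums_iff)
  finally have D_sum: "suminf D \<le> 2 * suminf H + 2 * p" .
  have D1_summable: "summable (\<lambda>y. D (y + 1))"
    using D_summable by (simp only: summable_iff_shift)
  have D1_sum: "(\<Sum>y. D (y + 1)) \<le> suminf D"
    using suminf_split_initial_segment[OF D_summable, of 1] D_nonneg by simp

  \<comment> \<open>Pointwise bound, below and above \<open>K\<close>\<close>
  define A B where "A = 6 * (h\<^sup>2 + h'\<^sup>2)" and "B = 24 * (h + h') * real K"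
  have AB: "A \<ge> 0" "B \<ge> 0" using h h' by (auto simp: A_def B_def)
  \<comment> \<open>Extending the tail by zero lets one inequality cover all \<open>y\<close> and be
    summed from 0.\<close>
  define E where "E y = (if y < K then 0 else F y)" for y
  have E_nonneg: "E y \<ge> 0" for y using nn by (simp add: E_def)
  have E_sums: "E sums mixture_tail K G"
  proof -
    have "summable (\<lambda>y. F (y + K))" using F_sums by (simp add: summable_iff_shift sums_summable)
    then have "(\<lambda>y. E (y + K)) sums mixture_tail K G"
      by (simp add: E_def mixture_tail_def F_def summable_sums)
    then show ?thesis by (subst (asm) sums_zero_iff_shift) (auto simp: E_def)
  qed
  have small: "(a y - b y)\<^sup>2 * g y \<le> A * D y + B * D (y + 1) + (h + h')\<^sup>2 * E y" for y
  proof (cases "y < K")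
    case True
    \<comment> \<open>From \<open>y < K\<close> follows \<open>y + 1 \<le> K\<close>, so
      \<open>K\<close> itself serves as the bound \<open>N\<close> on
      \<open>k = y + 1\<close>.\<close>
    have "(a y - b y)\<^sup>2 * g y \<le> A * D y + B * D (y + 1)"
      unfolding A_def B_def D_def using True
      by (intro bayes_diff_square_le[where k = "real (y + 1)"] nn a b) auto
    with True show ?thesis by (simp add: E_def)
  next
    case False
    have "\<bar>a y - b y\<bar> \<le> \<bar>h + h'\<bar>" using a(1,2)[of y] b(1,2)[of y] by linarith
    then have "(a y - b y)\<^sup>2 * g y \<le> (h + h')\<^sup>2 * F y"
      using nn F_split[of y] by (intro mult_mono) (auto simp: abs_le_square_iff)
    moreover have "A * D y + B * D (y + 1) \<ge> 0" using AB D_nonneg by simp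
    ultimately show ?thesis using False by (simp add: E_def)
  qed

  \<comment> \<open>Summation and comparison of constants\<close>
  define Q where "Q = (\<integral>\<theta>. indicator {h<..} \<theta> * \<theta> ^ 2 \<partial>G)"
  define U where "U y = A * D y + B * D (y + 1) + (h + h')\<^sup>2 * E y + h'\<^sup>2 * t y + t2 y" for y
  have t2_sums: "t2 sums Q" unfolding t2_def Q_def by (intro part_sums) auto
  have U_sums: "U sums (A * suminf D + B * (\<Sum>y. D (y + 1)) + (h + h')\<^sup>2 * mixture_tail K G
      + h'\<^sup>2 * p + Q)"
    unfolding U_def[abs_def]
    by (intro sums_add sums_mult summable_sums D_summable D1_summable E_sums t_sums t2_sums)
  have U: "(a y - c y)\<^sup>2 * F y \<le> U y" for y
    using bayes_regret_split[OF F_split cF nn(3,5,4) a(1,2)[of y] tc, of y] small[of y]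
    by (simp add: U_def)
  have U_nonneg: "U y \<ge> 0" for y
    by (rule order_trans[OF _ U]) (simp add: nn)
  have "regret G' G \<le> (\<Sum>y. ennreal (U y))"
    unfolding regret_def a_def[symmetric] c_def[symmetric] F_def[symmetric]
    by (intro suminf_le ennreal_leI U) auto
  also have "\<dots> = ennreal (suminf U)"
    using U_sums U_nonneg by (intro suminf_ennreal2) (auto intro: sums_summable)
  also have "suminf U = A * suminf D + B * (\<Sum>y. D (y + 1)) + (h + h')\<^sup>2 * mixture_tail K G
      + h'\<^sup>2 * p + Q"
    using U_sums by (simp add: sums_iff)
  also have "ennreal \<dots> \<le> ennreal ((2 * A + 2 * B) * (suminf H + 4 * p)
      + 2 * (h + h')\<^sup>2 * mixture_tail K G + 2 * (1 + 2 * sqrt 2) * sqrt ((M + h' ^ 4) * p))"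
  proof (rule ennreal_leI)
    \<comment> \<open>Both sums of \<open>D\<close> are at most \<open>2 * suminf H + 2 * p\<close>;
      enlarging \<open>2 * p\<close> to \<open>8 * p\<close> matches the factor 4 in the
      claim.\<close>
    have "A * suminf D + B * (\<Sum>y. D (y + 1))
        \<le> A * (2 * suminf H + 8 * p) + B * (2 * suminf H + 8 * p)"
      using AB D_sum D1_sum p by (intro add_mono mult_left_mono) auto
    also have "\<dots> = (2 * A + 2 * B) * (suminf H + 4 * p)" by (simp add: algebra_simps)
    finally have 1: "A * suminf D + B * (\<Sum>y. D (y + 1)) \<le> (2 * A + 2 * B) * (suminf H + 4 * p)" .
    have "mixture_tail K G \<ge> 0" using E_sums E_nonneg by (metis sums_le sums_zero)
    then have 2: "(h + h')\<^sup>2 * mixture_tail K G \<le> 2 * (h + h')\<^sup>2 * mixture_tail K G" by simp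
    have M: "M \<ge> 0" by (rule order_trans[OF _ M4(2)]) simp
    have h'4: "h' ^ 4 \<ge> 0" by simp
    define S where "S = sqrt ((M + h' ^ 4) * p)"
    have "Q \<le> sqrt ((\<integral>\<theta>. \<theta> ^ 4 \<partial>G) * p)"
      unfolding Q_def p_def using M4 int_ind[of 2 "{h<..}"]
      by (intro integral_square_on_le_sqrt) auto
    also have "\<dots> \<le> S"
      unfolding S_def using M4(2) h'4 p by (intro real_sqrt_le_mono mult_right_mono) linarith+
    finally have 3: "Q \<le> S" .
    \<comment> \<open>Because \<open>p \<le> 1\<close>, the term linear in \<open>p\<close> also
      fits under the square root.\<close>
    have "(h'\<^sup>2 * p)\<^sup>2 = h' ^ 4 * p * p" by (simp add: power2_eq_square power4_eq_xxxx)
    also have "\<dots> \<le> (M + h' ^ 4) * p * 1" using p M by (intro mult_mono) auto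
    finally have 4: "h'\<^sup>2 * p \<le> S" unfolding S_def by (intro real_le_rsqrt) simp
    \<comment> \<open>The two tail terms use \<open>2 * S\<close> of the claimed constant; the rest,
      \<open>4 * sqrt 2 * S\<close>, is nonnegative.\<close>
    have "0 \<le> sqrt 2 * S" using M h'4 p by (simp add: S_def)
    with 3 4 have "h'\<^sup>2 * p + Q \<le> 2 * (1 + 2 * sqrt 2) * S" by (simp add: algebra_simps)
    with 1 2 show "A * suminf D + B * (\<Sum>y. D (y + 1)) + (h + h')\<^sup>2 * mixture_tail K G + h'\<^sup>2 * p + Q
        \<le> (2 * A + 2 * B) * (suminf H + 4 * p) + 2 * (h + h')\<^sup>2 * mixture_tail K G
          + 2 * (1 + 2 * sqrt 2) * sqrt ((M + h' ^ 4) * p)"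
      unfolding S_def by linarith
  qed
  also have "2 * A + 2 * B = 12 * (h\<^sup>2 + h'\<^sup>2) + 48 * (h + h') * real K"
    by (simp add: A_def B_def)
  also have "suminf H = sq_hellinger (poisson_mixture G) (poisson_mixture G')"
    by (simp add: H_def[abs_def] sq_hellinger_def F_def f_def)
  finally show ?thesis unfolding p_def .
qed

end
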